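(* Let $\alpha=\frac{1+\sqrt5}{2}$ and $\beta=\frac{1-\sqrt5}{2}$. For every integer $n\ge0$, the $n$th hybrid Lucas spinor $LSH_n$ satisfies $$LSH_n=A\alpha^n+B\beta^n,$$ where $$A=\begin{bmatrix}\frac{2+h(3+\sqrt5)}{2}\\[2pt] 1+(2+\sqrt5)h\end{bmatrix},\qquad B=\begin{bmatrix}\frac{2+h(3-\sqrt5)}{2}\\[2pt] 1+(2-\sqrt5)h\end{bmatrix}.$$
   Context: $h$ is the hyperbolic unit: $h^2=1$, $h\notin\mathbb{R}$, so entries lie in the commutative ring of hyperbolic (split-complex) numbers $\{a+hb: a,b\in\mathbb{R}\}\cong\mathbb{R}[h]/(h^2-1)$. $L_n$ is the Lucas sequence: $L_0=2$, $L_1=1$, $L_{n+1}=L_n+L_{n-1}$. The $n$th hybrid Lucas spinor ($n\ge0$) is the column vector $$LSH_n=\begin{bmatrix}L_n+hL_{n+2}\\ L_n+hL_{n+3}\end{bmatrix}.$$ *)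

theory Defs
  imports "HOL-Analysis.Analysis"
begin

text \<open>The pair \<open>Hyperbolic a b\<close> is the hyperbolic (split-complex) number \<open>a + h b\<close>; see
  \<open>hyperbolic_eq\<close> below.\<close>

datatype hyperbolic = Hyperbolic (real_part: real) (hyp_part: real)

lemma hyperbolic_eq_iff: "z = w \<longleftrightarrow> real_part z = real_part w \<and> hyp_part z = hyp_part w"
  by (auto intro: hyperbolic.expand)

instantiation hyperbolic :: comm_ring_1
begin

definition "0 = Hyperbolic 0 0"
definition "1 = Hyperbolic 1 0"
definition "z + w = Hyperbolic (real_part z + real_part w) (hyp_part z + hyp_part w)"
definition "- z = Hyperbolic (- real_part z) (- hyp_part z)"
definition "z - w = Hyperbolic (real_part z - real_part w) (hyp_part z - hyp_part w)"
definition "z * w = Hyperbolic (real_part z * real_part w + hyp_part z * hyp_part w)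
                               (real_part z * hyp_part w + hyp_part z * real_part w)"

instance
  by standard
    (simp_all add: hyperbolic_eq_iff zero_hyperbolic_def one_hyperbolic_def plus_hyperbolic_def
      uminus_hyperbolic_def minus_hyperbolic_def times_hyperbolic_def algebra_simps)

end

instantiation hyperbolic :: real_algebra_1
begin

definition "r *\<^sub>R z = Hyperbolic (r * real_part z) (r * hyp_part z)"

instance
  by standard
    (simp_all add: hyperbolic_eq_iff plus_hyperbolic_def times_hyperbolic_def
      scaleR_hyperbolic_def algebra_simps)

end

definition hyp_unit :: hyperbolic
  where "hyp_unit = Hyperbolic 0 1"

lemma hyp_unit_square: "hyp_unit\<^sup>2 = 1"
  by (simp add: power2_eq_square hyp_unit_def times_hyperbolic_def one_hyperbolic_def)

lemma hyp_unit_not_real: "hyp_unit \<notin> \<real>"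
  by (auto simp: Reals_def of_real_def hyp_unit_def scaleR_hyperbolic_def one_hyperbolic_def)

lemma hyperbolic_eq: "Hyperbolic a b = of_real a + hyp_unit * of_real b"
  by (simp add: of_real_def hyp_unit_def scaleR_hyperbolic_def one_hyperbolic_def
      plus_hyperbolic_def times_hyperbolic_def)

fun lucas :: "nat \<Rightarrow> nat" where
  "lucas 0 = 2"
| "lucas (Suc 0) = 1"
| "lucas (Suc (Suc n)) = lucas (Suc n) + lucas n"

definition LSH :: "nat \<Rightarrow> hyperbolic ^ 2" where
  "LSH n = vector [of_nat (lucas n) + hyp_unit * of_nat (lucas (n + 2)),
                   of_nat (lucas n) + hyp_unit * of_nat (lucas (n + 3))]"

end

theory Submission
  imports Defs
begin

text \<open>The constants hide powers of the roots: the entries of \<open>A\<close> are 1 +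
  h\<alpha>^2 and 1 + h\<alpha>^3, and those of \<open>B\<close> are the same in \<beta>. Hence
  \<alpha>^n A + \<beta>^n B has real parts \<alpha>^n + \<beta>^n and hyperbolic parts
  \<alpha>^(n+k) + \<beta>^(n+k) with k = 2, 3, which \<open>lucas_Binet\<close> turns into Lucas
  numbers.\<close>

lemma lucas_Binet: "real (lucas n) = ((1 + sqrt 5) / 2) ^ n + ((1 - sqrt 5) / 2) ^ n"
proof (induction n rule: lucas.induct)
  case (3 n)
  \<comment> \<open>Both numbers are roots of x^2 = x + 1; multiplying by x^n makes their powers
    obey the Lucas recurrence.\<close>
  have "((1 + sqrt 5) / 2)\<^sup>2 = (1 + sqrt 5) / 2 + 1" "((1 - sqrt 5) / 2)\<^sup>2 = (1 - sqrt 5) / 2 + 1"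
    by (simp_all add: power2_eq_square field_simps)
  then have "((1 + sqrt 5) / 2) ^ Suc (Suc n) = ((1 + sqrt 5) / 2) ^ Suc n + ((1 + sqrt 5) / 2) ^ n"
    "((1 - sqrt 5) / 2) ^ Suc (Suc n) = ((1 - sqrt 5) / 2) ^ Suc n + ((1 - sqrt 5) / 2) ^ n"
    by (metis distrib_right mult.assoc mult_1 power2_eq_square power_Suc)+
  with 3 show ?case
    by (simp only: lucas.simps of_nat_add)
qed (auto simp: field_simps)

text \<open>The exponents 3 and 2, here and in \<open>Binet_roots_squared\<close>, are the index
  shifts in the entries of \<open>LSH\<close>.\<close>

lemma Binet_roots_cubed:
  "((1 + sqrt 5) / 2) ^ 3 = 2 + sqrt 5" "((1 - sqrt 5) / 2) ^ 3 = 2 - sqrt 5"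
  by (simp_all add: power3_eq_cube field_simps)

lemma Binet_roots_squared:
  "((1 + sqrt 5) / 2)\<^sup>2 = (3 + sqrt 5) / 2" "((1 - sqrt 5) / 2)\<^sup>2 = (3 - sqrt 5) / 2"
  by (simp_all add: power2_eq_square field_simps)

text \<open>Writing embedded scalars as pairs reduces hyperbolic identities to real
  coordinates.\<close>

lemma of_real_hyperbolic: "of_real x = Hyperbolic x 0"
  by (simp add: of_real_def scaleR_hyperbolic_def one_hyperbolic_def)

lemma of_nat_hyperbolic: "of_nat k = Hyperbolic (real k) 0"
  by (metis of_real_hyperbolic of_real_of_nat_eq)

lemma numeral_hyperbolic: "numeral k = Hyperbolic (numeral k) 0"
  by (metis of_real_hyperbolic of_real_numeral)

theorem theorem4p6:
  fixes \<alpha> \<beta> :: real and A B :: "hyperbolic ^ 2" and n :: nat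
  defines "\<alpha> \<equiv> (1 + sqrt 5) / 2"
    and "\<beta> \<equiv> (1 - sqrt 5) / 2"
    and "A \<equiv> vector [(2 + hyp_unit * (3 + of_real (sqrt 5))) /\<^sub>R 2,
                     1 + (2 + of_real (sqrt 5)) * hyp_unit]"
    and "B \<equiv> vector [(2 + hyp_unit * (3 - of_real (sqrt 5))) /\<^sub>R 2,
                     1 + (2 - of_real (sqrt 5)) * hyp_unit]"
  shows "LSH n = \<alpha> ^ n *\<^sub>R A + \<beta> ^ n *\<^sub>R B"
proof -
  note ops = plus_hyperbolic_def minus_hyperbolic_def times_hyperbolic_def one_hyperbolic_def
    scaleR_hyperbolic_def hyp_unit_def of_real_hyperbolic of_nat_hyperbolic numeral_hyperbolic
  have A: "A = vector [Hyperbolic 1 (\<alpha>\<^sup>2), Hyperbolic 1 (\<alpha> ^ 3)]"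
    unfolding A_def \<alpha>_def Binet_roots_squared Binet_roots_cubed by (simp add: ops)
  have B: "B = vector [Hyperbolic 1 (\<beta>\<^sup>2), Hyperbolic 1 (\<beta> ^ 3)]"
    unfolding B_def \<beta>_def Binet_roots_squared Binet_roots_cubed by (simp add: ops)
  have L: "real (lucas k) = \<alpha> ^ k + \<beta> ^ k" for k
    unfolding \<alpha>_def \<beta>_def by (rule lucas_Binet)
  show ?thesis
    unfolding A B LSH_def vec_eq_iff forall_2 ops
    \<comment> \<open>Without \<open>lucas.simps\<close> the shifted Lucas numbers are not expanded
      by the recurrence, so \<open>L\<close> rewrites them directly.\<close>
    by (simp only: vector_2 vector_add_component vector_scaleR_component)
       (simp add: ops L power_add power2_eq_square power3_eq_cube mult_ac del: lucas.simps)
qed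

end
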